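(* Let $G$ be a group acting acylindrically (by isometries) on a hyperbolic length space $X$. There exists a constant $C>0$ such that for every finite subset $U\subset G$ with $\lambda(U)>C$, one of the following holds: \begin{enumerate} \item either $|U|\leq C$, \item or there is a subset $W\subset U^2$ freely generating a free sub-semigroup of $G$, of cardinality $$|W|\geq \frac1C\,\frac1{\lambda(U)}\,|U|.$$ \end{enumerate}
   Context: The distance in $X$ is denoted $|x-y|$; hyperbolic means hyperbolic in the sense of Gromov. $U^2=\{uv : u,v\in U\}$. The $\ell^\infty$-energy of a subset $U\subset G$ is $\lambda(U)=\inf_{x\in X}\sup_{u\in U}|ux-x|$. The action of $G$ on $X$ is acylindrical if there exist two functions $N,\kappa:\mathbb R_+\to\mathbb R_+$ such that for every $r\geq0$ and all points $x,y\in X$ with $|x-y|\geq\kappa(r)$, there are at most $N(r)$ elements $g\in G$ such that $|x-gx|\leq r$ and $|y-gy|\leq r$. A subset $W\subset G$ freely generates a free sub-semigroup if the canonical map from the free monoid on $W$ to $G$ is injective. *)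

theory Defs
  imports "HOL-Analysis.Analysis" "HOL-Algebra.Group_Action"
begin

text \<open>The space \<open>X\<close> is a type of class \<open>metric_space\<close> (in particular it is nonempty), and an action of
  \<open>G\<close> on it is a \<^const>\<open>group_action\<close> of \<open>G\<close> on \<open>UNIV\<close>. Properties of the space are
  predicates on \<open>TYPE('x)\<close>.\<close>

definition path_length :: "(real \<Rightarrow> 'x::metric_space) \<Rightarrow> ennreal" where
  "path_length \<gamma> = (SUP ts\<in>{ts. sorted ts \<and> set ts \<subseteq> {0..1}}.
     ennreal (\<Sum>i<length ts - 1. dist (\<gamma> (ts ! i)) (\<gamma> (ts ! Suc i))))"

text \<open>The infimum below is \<open>\<infinity>\<close> if no path joins the two points, so a length space is
  path connected.\<close>

definition length_space :: "'x::metric_space itself \<Rightarrow> bool" where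
  "length_space _ \<longleftrightarrow> (\<forall>x y :: 'x. ennreal (dist x y) =
     (INF \<gamma>\<in>{\<gamma>. path \<gamma> \<and> pathstart \<gamma> = x \<and> pathfinish \<gamma> = y}. path_length \<gamma>))"

definition gromov_product :: "'x::metric_space \<Rightarrow> 'x \<Rightarrow> 'x \<Rightarrow> real" where
  "gromov_product w x y = (dist x w + dist y w - dist x y) / 2"

definition gromov_hyperbolic :: "'x::metric_space itself \<Rightarrow> bool" where
  "gromov_hyperbolic _ \<longleftrightarrow> (\<exists>\<delta>\<ge>0. \<forall>w x y z :: 'x.
     gromov_product w x z \<ge> min (gromov_product w x y) (gromov_product w y z) - \<delta>)"

definition isometric_action ::
    "('g, 'm) monoid_scheme \<Rightarrow> ('g \<Rightarrow> 'x::metric_space \<Rightarrow> 'x) \<Rightarrow> bool" where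
  "isometric_action G \<phi> \<longleftrightarrow> group_action G UNIV \<phi> \<and>
     (\<forall>g\<in>carrier G. \<forall>x y. dist (\<phi> g x) (\<phi> g y) = dist x y)"

definition acylindrical ::
    "('g, 'm) monoid_scheme \<Rightarrow> ('g \<Rightarrow> 'x::metric_space \<Rightarrow> 'x) \<Rightarrow> bool" where
  "acylindrical G \<phi> \<longleftrightarrow> (\<exists>N \<kappa> :: real \<Rightarrow> real. (\<forall>r\<ge>0. N r \<ge> 0 \<and> \<kappa> r \<ge> 0) \<and>
     (\<forall>r\<ge>0. \<forall>x y. dist x y \<ge> \<kappa> r \<longrightarrow>
        finite {g \<in> carrier G. dist x (\<phi> g x) \<le> r \<and> dist y (\<phi> g y) \<le> r} \<and>
        real (card {g \<in> carrier G. dist x (\<phi> g x) \<le> r \<and> dist y (\<phi> g y) \<le> r}) \<le> N r))"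

text \<open>The energy takes values in \<open>[0, \<infinity>]\<close>, so that it makes sense for every subset \<open>U\<close>; it is
  finite for finite \<open>U\<close>, and \<open>0\<close> for empty \<open>U\<close>.\<close>

definition linf_energy :: "('g \<Rightarrow> 'x::metric_space \<Rightarrow> 'x) \<Rightarrow> 'g set \<Rightarrow> ennreal" where
  "linf_energy \<phi> U = (INF x. SUP u\<in>U. ennreal (dist (\<phi> u x) x))"

text \<open>The free monoid on \<open>W\<close> is \<open>lists W\<close> with concatenation.\<close>

definition word_prod :: "('g, 'm) monoid_scheme \<Rightarrow> 'g list \<Rightarrow> 'g" where
  "word_prod G ws = foldr (\<lambda>a b. a \<otimes>\<^bsub>G\<^esub> b) ws \<one>\<^bsub>G\<^esub>"

definition freely_generates_semigroup :: "('g, 'm) monoid_scheme \<Rightarrow> 'g set \<Rightarrow> bool" where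
  "freely_generates_semigroup G W \<longleftrightarrow> W \<subseteq> carrier G \<and> inj_on (word_prod G) (lists W)"

end

theory Submission imports Defs begin

text \<open>Choose a point \<open>p\<close> that almost minimises the mean displacement of \<open>U\<close>, not the maximal
  one, and a large constant \<open>R\<close>.

  If a definite proportion of the \<open>u \<in> U\<close> move \<open>p\<close> by at most \<open>R\<close>, pick \<open>v \<in> U\<close> that moves \<open>p\<close> far.
  By acylindricity all but boundedly many of the points \<open>u v p\<close> leave the direction of
  \<open>v\<^sup>-\<^sup>1 p\<close> quickly, so the elements \<open>u v\<close> form a reduced set.

  Otherwise almost all \<open>u\<close> move \<open>p\<close> by more than \<open>R\<close>. Moving \<open>p\<close> towards a point \<open>a\<close> does not decrease
  the mean displacement, so not much more than half of the points \<open>u p\<close>, \<open>u\<^sup>-\<^sup>1 p\<close> lie in the direction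
  of \<open>a\<close>. A counting argument then yields \<open>v \<in> U\<close> and a definite proportion of \<open>u \<in> U\<close> for which
  neither of the words \<open>u v\<close> and \<open>v u\<close> backtracks. By the Markov inequality one may assume
  that these \<open>u\<close> move \<open>p\<close> by \<open>O(\<lambda>(U))\<close>; restricting them to one annulus around \<open>p\<close>
  costs the factor \<open>\<lambda>(U)\<close>.

  In both cases the points \<open>u v p\<close> are almost equidistant from \<open>p\<close>, and acylindricity bounds the
  number of them in a ball, so a definite proportion is pairwise far apart. The
  corresponding \<open>u v\<close> generate a free semigroup by the local-to-global principle for quasi-geodesics.\<close>

section \<open>Gromov products and points on almost shortest paths\<close>

lemma gromov_product_commute: "gromov_product w x y = gromov_product w y x"
  by (simp add: gromov_product_def dist_commute)

lemma gromov_product_nonneg: "0 \<le> gromov_product w x y"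
  using dist_triangle2[of x y w] by (simp add: gromov_product_def)

lemma gromov_product_le: "gromov_product w x y \<le> dist y w"
  using dist_triangle[of x w y] by (simp add: gromov_product_def dist_commute)

lemma gromov_product_base: "gromov_product w x y \<le> gromov_product w' x y + dist w w'"
  using dist_triangle[of x w w'] dist_triangle[of y w w']
  by (simp add: gromov_product_def dist_commute field_simps)

lemma gromov_product_move: "gromov_product w x y \<le> gromov_product w x' y + dist x x'"
  using dist_triangle[of x w x'] dist_triangle[of x' y x]
  by (simp add: gromov_product_def dist_commute field_simps)

text \<open>Substitute for a point on a geodesic: a path of length below \<open>dist p a + e\<close>
  meets the sphere of radius \<open>r\<close> by the intermediate value theorem, and the broken line
  through that point is no longer than the path.\<close>

lemma length_space_point:
  fixes a p :: "'x::metric_space"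
  assumes len: "length_space TYPE('x)" and r: "0 \<le> r" "r \<le> dist a p" and e: "e > 0"
  obtains q where "dist q p = r" "dist q a \<le> dist a p - r + e"
proof -
  have "ennreal (dist p a) = (INF \<gamma>\<in>{\<gamma>. path \<gamma> \<and> pathstart \<gamma> = p \<and> pathfinish \<gamma> = a}. path_length \<gamma>)"
    using len unfolding length_space_def by blast
  moreover have "ennreal (dist p a) < ennreal (dist p a + e)"
    using e by (simp add: ennreal_less_iff)
  ultimately have "\<exists>\<gamma>\<in>{\<gamma>. path \<gamma> \<and> pathstart \<gamma> = p \<and> pathfinish \<gamma> = a}.
      path_length \<gamma> < ennreal (dist p a + e)"
    by (simp only: INF_less_iff)
  then obtain \<gamma> where g: "path \<gamma>" "\<gamma> 0 = p" "\<gamma> 1 = a" "path_length \<gamma> < ennreal (dist p a + e)"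
    by (auto simp: pathstart_def pathfinish_def)
  have "continuous_on {0..1} (\<lambda>t. dist (\<gamma> t) p)"
    using g(1) unfolding path_def by (intro continuous_intros)
  then obtain t where t: "0 \<le> t" "t \<le> 1" "dist (\<gamma> t) p = r"
    using IVT'[of "\<lambda>t. dist (\<gamma> t) p" 0 r 1] g r by auto
  have "ennreal (\<Sum>i<length [0,t,1] - 1. dist (\<gamma> ([0,t,1] ! i)) (\<gamma> ([0,t,1] ! Suc i))) \<le> path_length \<gamma>"
    unfolding path_length_def by (rule SUP_upper) (use t in auto)
  then have "ennreal (dist p (\<gamma> t) + dist (\<gamma> t) a) \<le> path_length \<gamma>"
    by (simp add: numeral_2_eq_2 g)
  then have "ennreal (dist p (\<gamma> t) + dist (\<gamma> t) a) < ennreal (dist p a + e)"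
    using g(4) by (rule le_less_trans)
  then have "dist p (\<gamma> t) + dist (\<gamma> t) a < dist p a + e"
    using e by (simp add: ennreal_less_iff del: ennreal_plus)
  then show thesis
    using that[of "\<gamma> t"] t by (simp add: dist_commute)
qed

section \<open>Selecting large subsets of finite sets\<close>

text \<open>By maximality, the \<open>R\<close>-neighbourhoods of the members of a maximal
  independent set cover \<open>V\<close>.\<close>

lemma separated_subset:
  fixes N :: real
  assumes "finite V" and sym: "\<And>u w. R u w \<Longrightarrow> R w u" and refl: "\<And>u. u \<in> V \<Longrightarrow> R u u"
    and deg: "\<And>u. u \<in> V \<Longrightarrow> real (card {w \<in> V. R u w}) \<le> N"
  obtains I where "I \<subseteq> V" "\<And>u w. u \<in> I \<Longrightarrow> w \<in> I \<Longrightarrow> u \<noteq> w \<Longrightarrow> \<not> R u w"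
    "real (card V) \<le> N * real (card I)"
proof -
  define \<I> where "\<I> = {I. I \<subseteq> V \<and> (\<forall>u\<in>I. \<forall>w\<in>I. u \<noteq> w \<longrightarrow> \<not> R u w)}"
  have "finite \<I>" "{} \<in> \<I>"
    using assms(1) by (auto simp: \<I>_def intro: finite_subset[of _ "Pow V"])
  then obtain I where I: "I \<in> \<I>" and max: "\<And>J. J \<in> \<I> \<Longrightarrow> I \<subseteq> J \<Longrightarrow> J = I"
    using finite_has_maximal[of \<I>] by blast
  have "V \<subseteq> (\<Union>u\<in>I. {w \<in> V. R u w})"
  proof
    fix w assume w: "w \<in> V"
    show "w \<in> (\<Union>u\<in>I. {w \<in> V. R u w})"
    proof (rule ccontr)
      assume *: "w \<notin> (\<Union>u\<in>I. {w \<in> V. R u w})"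
      then have "insert w I \<in> \<I>" using I w sym by (auto simp: \<I>_def)
      then have "w \<in> I" using max[of "insert w I"] by auto
      with * w refl show False by auto
    qed
  qed
  moreover have fI: "finite I" using I assms(1) by (auto simp: \<I>_def intro: finite_subset)
  ultimately have "card V \<le> card (\<Union>u\<in>I. {w \<in> V. R u w})"
    using assms(1) by (intro card_mono) auto
  also have "\<dots> \<le> (\<Sum>u\<in>I. card {w \<in> V. R u w})" using fI by (rule card_UN_le)
  finally have "real (card V) \<le> (\<Sum>u\<in>I. real (card {w \<in> V. R u w}))"
    by (metis of_nat_le_iff of_nat_sum)
  also have "\<dots> \<le> (\<Sum>u\<in>I. N)" using I deg by (intro sum_mono) (auto simp: \<I>_def)
  finally show thesis using that[of I] I by (auto simp: \<I>_def mult.commute)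
qed

text \<open>The integer parts of \<open>f\<close> take at most \<open>M + 1\<close> values, so the
  largest fibre will do. Applied with \<open>M = 200 * l\<close>, it is the source of the energy in
  the final bound.\<close>

lemma pigeonhole_bands:
  fixes f :: "'a \<Rightarrow> real"
  assumes "finite V" "\<And>u. u \<in> V \<Longrightarrow> 0 \<le> f u \<and> f u \<le> M"
  obtains V' where "V' \<subseteq> V" "\<forall>u\<in>V'. \<forall>w\<in>V'. f u \<le> f w + 1"
    "real (card V) \<le> (M + 1) * real (card V')"
proof (cases "V = {}")
  case True
  then show ?thesis using that[of "{}"] by auto
next
  case False
  define b where "b u = nat \<lfloor>f u\<rfloor>" for u
  have M: "0 \<le> M" using False assms(2) by fastforce
  have "b ` V \<subseteq> {..nat \<lfloor>M\<rfloor>}"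
    using assms(2) by (auto simp: b_def intro!: nat_mono floor_mono)
  then have "card (b ` V) \<le> Suc (nat \<lfloor>M\<rfloor>)"
    by (metis card_atMost card_mono finite_atMost)
  then have cb: "real (card (b ` V)) \<le> M + 1" using M by linarith
  define m where "m = Max ((\<lambda>k. card {u \<in> V. b u = k}) ` b ` V)"
  have "m \<in> (\<lambda>k. card {u \<in> V. b u = k}) ` b ` V"
    unfolding m_def using False assms(1) by (intro Max_in) auto
  then obtain k where k: "m = card {u \<in> V. b u = k}" by auto
  have "card V = (\<Sum>k\<in>b ` V. card {u \<in> V. b u = k})"
    using sum.image_gen[OF assms(1), of "\<lambda>_. 1::nat" b] by simp
  also have "\<dots> \<le> card (b ` V) * m"
    using assms(1) by (intro sum_bounded_above[of "b ` V" _ m, simplified]) (auto simp: m_def)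
  finally have "real (card V) \<le> real (card (b ` V)) * real m"
    by (metis of_nat_le_iff of_nat_mult)
  also have "\<dots> \<le> (M + 1) * real m" using cb by (intro mult_right_mono) auto
  finally have "real (card V) \<le> (M + 1) * real (card {u \<in> V. b u = k})" by (simp add: k)
  moreover have "f u \<le> f w + 1" if "u \<in> {u \<in> V. b u = k}" "w \<in> {u \<in> V. b u = k}" for u w
  proof -
    have "nat \<lfloor>f u\<rfloor> = nat \<lfloor>f w\<rfloor>" "0 \<le> f u" "0 \<le> f w" using that assms(2) by (auto simp: b_def)
    then have "\<lfloor>f u\<rfloor> = \<lfloor>f w\<rfloor>" by (simp add: eq_nat_nat_iff)
    then show ?thesis by linarith
  qed
  ultimately show ?thesis using that[of "{u \<in> V. b u = k}"] by blast
qed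

section \<open>The action: transport of Gromov products and translates\<close>

text \<open>With \<open>1 \<le> \<delta>\<close>, the constant \<delta> can also serve as the
  positive slack in almost shortest paths and almost minimal energy, and absorb the width 1 of an
  annulus.\<close>

locale acylindrical_action = group_action G UNIV \<phi>
  for G :: "('g, 'm) monoid_scheme" and \<phi> :: "'g \<Rightarrow> 'x::metric_space \<Rightarrow> 'x" +
  fixes \<delta> :: real and N \<kappa> :: "real \<Rightarrow> real"
  assumes len: "length_space TYPE('x)"
    and delta: "1 \<le> \<delta>"
    and hyp: "\<And>w x y z :: 'x. gromov_product w x z \<ge> min (gromov_product w x y) (gromov_product w y z) - \<delta>"
    and isom: "\<And>g x y. g \<in> carrier G \<Longrightarrow> dist (\<phi> g x) (\<phi> g y) = dist x y"
    and N_nonneg: "\<And>r. 0 \<le> r \<Longrightarrow> 0 \<le> N r"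
    and kappa_nonneg: "\<And>r. 0 \<le> r \<Longrightarrow> 0 \<le> \<kappa> r"
    and acyl: "\<And>r x y. 0 \<le> r \<Longrightarrow> \<kappa> r \<le> dist x y \<Longrightarrow>
        finite {g \<in> carrier G. dist x (\<phi> g x) \<le> r \<and> dist y (\<phi> g y) \<le> r} \<and>
        real (card {g \<in> carrier G. dist x (\<phi> g x) \<le> r \<and> dist y (\<phi> g y) \<le> r}) \<le> N r"
begin

sublocale group G
  using group_hom group_hom.axioms(1) by blast

lemma act_mult: "g \<in> carrier G \<Longrightarrow> h \<in> carrier G \<Longrightarrow> \<phi> (g \<otimes>\<^bsub>G\<^esub> h) x = \<phi> g (\<phi> h x)"
  using composition_rule by simp

lemma act_one: "\<phi> \<one>\<^bsub>G\<^esub> x = x"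
  using id_eq_one by (metis UNIV_I restrict_apply')

lemma act_inv: "g \<in> carrier G \<Longrightarrow> \<phi> g (\<phi> (inv\<^bsub>G\<^esub> g) x) = x"
  by (metis act_mult act_one inv_closed r_inv)

lemma dist_act_inv: "g \<in> carrier G \<Longrightarrow> dist (\<phi> (inv\<^bsub>G\<^esub> g) x) y = dist x (\<phi> g y)"
  by (metis act_inv isom)

lemma dist_act_inv': "g \<in> carrier G \<Longrightarrow> dist x (\<phi> (inv\<^bsub>G\<^esub> g) y) = dist (\<phi> g x) y"
  by (metis dist_act_inv dist_commute)

lemma gp_act: "g \<in> carrier G \<Longrightarrow>
    gromov_product (\<phi> g p) (\<phi> g x) (\<phi> g y) = gromov_product p x y"
  by (simp add: gromov_product_def isom)

text \<open>In the triangle p, g p, g x the products at p and at g p add up to the side between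
  them, and g^-1 carries the second one to base point p. Hence little cancellation before x means
  that g x is seen from p in the direction of g p.\<close>

lemma gp_continue:
  assumes "g \<in> carrier G"
  shows "gromov_product p (\<phi> g p) (\<phi> g x) = dist (\<phi> g p) p - gromov_product p (\<phi> (inv\<^bsub>G\<^esub> g) p) x"
  using isom[OF assms, of p x] dist_act_inv[OF assms, of p p] dist_act_inv[OF assms, of p x]
  by (simp add: gromov_product_def dist_commute field_simps)

lemma hyp3:
  fixes w :: 'x
  shows "gromov_product w x z \<ge>
    min (gromov_product w x y) (min (gromov_product w y y') (gromov_product w y' z)) - 2 * \<delta>"
  using hyp[of w x y z] hyp[of w y y' z] delta by linarith

lemma four_point:
  fixes w :: 'x
  shows "dist x z + dist y w \<le> max (dist z w + dist x y) (dist x w + dist y z) + 2 * \<delta>"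
  using hyp[of w x y z] by (simp add: gromov_product_def min_def max_def field_simps split: if_splits)

text \<open>Left multiplication by u^-1 injects these \<open>w\<close> into the set controlled by
  acylindricity.\<close>

lemma few_translates:
  assumes "V \<subseteq> carrier G" "u \<in> carrier G" "0 \<le> r" "\<kappa> r \<le> dist x y"
  shows "real (card {w \<in> V. dist (\<phi> u x) (\<phi> w x) \<le> r \<and> dist (\<phi> u y) (\<phi> w y) \<le> r}) \<le> N r"
proof -
  let ?A = "{w \<in> V. dist (\<phi> u x) (\<phi> w x) \<le> r \<and> dist (\<phi> u y) (\<phi> w y) \<le> r}"
  let ?B = "{g \<in> carrier G. dist x (\<phi> g x) \<le> r \<and> dist y (\<phi> g y) \<le> r}"
  have ac: "finite ?B" "real (card ?B) \<le> N r" using acyl assms(3,4) by blast+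
  have "card ?A \<le> card ?B"
  proof (rule card_inj_on_le[OF _ _ ac(1)])
    show "inj_on (\<lambda>w. inv\<^bsub>G\<^esub> u \<otimes>\<^bsub>G\<^esub> w) ?A"
      using assms(1,2) by (auto intro!: inj_onI simp: subset_iff Units_eq)
    show "(\<lambda>w. inv\<^bsub>G\<^esub> u \<otimes>\<^bsub>G\<^esub> w) ` ?A \<subseteq> ?B"
      using assms(1,2) by (auto simp: act_mult dist_act_inv' subset_iff)
  qed
  with ac(2) show ?thesis by linarith
qed

section \<open>Local-to-global principle and free semigroups\<close>

lemma word_prod_Cons: "word_prod G (w # ws) = w \<otimes>\<^bsub>G\<^esub> word_prod G ws"
  by (simp add: word_prod_def)

lemma word_prod_closed: "ws \<in> lists W \<Longrightarrow> W \<subseteq> carrier G \<Longrightarrow> word_prod G ws \<in> carrier G"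
  by (induction ws) (auto simp: word_prod_def)

text \<open>The error does not grow with the word. By induction the endpoint of
  \<open>v # ws\<close> has product at least
  \<open>dist (\<phi> v p) p - \<alpha> - \<delta>\<close> with v p, which exceeds
  \<open>\<alpha> + \<delta>\<close> by \<open>long\<close>. As w^-1 p and v p have product at most
  \<alpha>, hyperbolicity leaves only the claimed bound.\<close>

lemma reduced_word:
  assumes W: "W \<subseteq> carrier G"
    and reduced: "\<And>w w'. w \<in> W \<Longrightarrow> w' \<in> W \<Longrightarrow> gromov_product p (\<phi> (inv\<^bsub>G\<^esub> w) p) (\<phi> w' p) \<le> \<alpha>"
    and long: "\<And>w. w \<in> W \<Longrightarrow> 2 * \<alpha> + 2 * \<delta> < dist (\<phi> w p) p"
    and "ws \<in> lists W" "w \<in> W"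
  shows "gromov_product p (\<phi> (inv\<^bsub>G\<^esub> w) p) (\<phi> (word_prod G ws) p) \<le> \<alpha> + \<delta>"
  using assms(4,5)
proof (induction ws arbitrary: w)
  case Nil
  have "0 \<le> \<alpha>" using reduced[of w w] Nil.prems gromov_product_nonneg order_trans by blast
  then show ?case using delta by (simp add: word_prod_def act_one gromov_product_def)
next
  case (Cons v ws)
  then have v: "v \<in> W" "v \<in> carrier G" "ws \<in> lists W" using W by auto
  let ?x = "\<phi> (word_prod G (v # ws)) p"
  have x: "?x = \<phi> v (\<phi> (word_prod G ws) p)"
    using v W word_prod_closed by (simp add: word_prod_Cons act_mult)
  have "gromov_product p (\<phi> v p) ?x \<ge> dist (\<phi> v p) p - \<alpha> - \<delta>"
    unfolding x gp_continue[OF v(2)] using Cons.IH[OF v(1)] by simp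
  moreover have "gromov_product p (\<phi> (inv\<^bsub>G\<^esub> w) p) (\<phi> v p) \<le> \<alpha>"
    using reduced Cons.prems v by blast
  ultimately show ?case
    using hyp[of p "\<phi> (inv\<^bsub>G\<^esub> w) p" ?x "\<phi> v p"] long[OF v(1)] gromov_product_commute[of p "\<phi> v p" ?x]
    by linarith
qed

text \<open>The endpoint of a word determines its first letter, because it is seen from p in the
  direction of w p for almost the whole length of w. Cancelling that letter and induction give
  injectivity.\<close>

lemma reduced_free:
  assumes W: "W \<subseteq> carrier G"
    and reduced: "\<And>w w'. w \<in> W \<Longrightarrow> w' \<in> W \<Longrightarrow> gromov_product p (\<phi> (inv\<^bsub>G\<^esub> w) p) (\<phi> w' p) \<le> \<alpha>"
    and long: "\<And>w. w \<in> W \<Longrightarrow> 2 * \<alpha> + 2 * \<delta> < dist (\<phi> w p) p"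
    and band: "\<And>w w'. w \<in> W \<Longrightarrow> w' \<in> W \<Longrightarrow> dist (\<phi> w p) p \<le> dist (\<phi> w' p) p + c"
    and sep: "\<And>w w'. w \<in> W \<Longrightarrow> w' \<in> W \<Longrightarrow> w \<noteq> w' \<Longrightarrow> c + 2 * \<alpha> + 4 * \<delta> < dist (\<phi> w p) (\<phi> w' p)"
  shows "freely_generates_semigroup G W"
proof -
  have prefix: "gromov_product p (\<phi> w p) (\<phi> (word_prod G (w # ws)) p) \<ge> dist (\<phi> w p) p - \<alpha> - \<delta>"
    if "w \<in> W" "ws \<in> lists W" for w ws
  proof -
    have "\<phi> (word_prod G (w # ws)) p = \<phi> w (\<phi> (word_prod G ws) p)"
      using that W word_prod_closed by (simp add: word_prod_Cons act_mult subset_iff)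
    then show ?thesis
      using reduced_word[OF W reduced long that(2,1)] gp_continue[of w p] that(1) W
      by (simp add: subset_iff)
  qed
  \<comment> \<open>If the endpoint were p, the product bounded below by \<open>prefix\<close> would
    be 0, against \<open>long\<close>.\<close>
  have ne: "word_prod G (w # ws) \<noteq> word_prod G []" if "w \<in> W" "ws \<in> lists W" for w ws
  proof
    assume "word_prod G (w # ws) = word_prod G []"
    then have "gromov_product p (\<phi> w p) p \<ge> dist (\<phi> w p) p - \<alpha> - \<delta>"
      using prefix[OF that] by (simp add: word_prod_def act_one)
    moreover have "0 \<le> \<alpha>"
      using reduced[OF that(1,1)] gromov_product_nonneg order_trans by blast
    ultimately show False
      using long[OF that(1)] delta by (simp add: gromov_product_def)
  qed
  have hd: "w = w'"
    if eq: "word_prod G (w # ws) = word_prod G (w' # ws')"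
      and w: "w \<in> W" "w' \<in> W" "ws \<in> lists W" "ws' \<in> lists W" for w w' ws ws'
  proof (rule ccontr)
    assume "w \<noteq> w'"
    let ?x = "\<phi> (word_prod G (w # ws)) p"
    \<comment> \<open>Both letters are compared through the common endpoint. Together with
      \<open>band\<close> the bound puts w p and w' p within
      \<open>c + 2 * \<alpha> + 4 * \<delta>\<close>, which \<open>sep\<close> excludes.\<close>
    have "gromov_product p (\<phi> w p) (\<phi> w' p)
        \<ge> min (dist (\<phi> w p) p - \<alpha> - \<delta>) (dist (\<phi> w' p) p - \<alpha> - \<delta>) - \<delta>"
      using hyp[of p "\<phi> w p" ?x "\<phi> w' p"] prefix[OF w(1,3)] prefix[OF w(2,4)]
        gromov_product_commute[of p "\<phi> w' p" ?x] eq by (simp add: min_def split: if_splits)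
    then show False
      using sep[OF w(1,2) \<open>w \<noteq> w'\<close>] band[OF w(1,2)] band[OF w(2,1)]
      by (simp add: gromov_product_def min_def split: if_splits)
  qed
  have "ws = ws'" if "ws \<in> lists W" "ws' \<in> lists W" "word_prod G ws = word_prod G ws'" for ws ws'
    using that
  proof (induction ws arbitrary: ws')
    case Nil
    then show ?case using ne[of "hd ws'" "tl ws'"] by (cases ws') auto
  next
    case (Cons w ws)
    then obtain w' us where ws': "ws' = w' # us"
      using ne[of w ws] by (cases ws') auto
    then have "w = w'" using Cons.hyps Cons.prems by (intro hd[of w ws w' us]) auto
    have us: "us \<in> lists W" using Cons.prems(1) ws' by simp
    have cl: "word_prod G ws \<in> carrier G" "word_prod G us \<in> carrier G" "w \<in> carrier G"
      using word_prod_closed[OF _ W] us Cons.hyps W by auto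
    have "w \<otimes>\<^bsub>G\<^esub> word_prod G ws = w \<otimes>\<^bsub>G\<^esub> word_prod G us"
      using Cons.prems(2) \<open>w = w'\<close> ws' by (simp only: word_prod_Cons)
    then have "word_prod G ws = word_prod G us"
      using cl by (simp add: Units_eq)
    then show ?case using Cons.IH[OF us] \<open>w = w'\<close> ws' by simp
  qed
  then show ?thesis
    unfolding freely_generates_semigroup_def using W by (intro conjI inj_onI)
qed

text \<open>Two elements conflict if u v p and u' v p are too close for \<open>reduced_free\<close>.
  Then \<open>close\<close> makes u p and u' p close as well, so acylindricity at the distant points
  p and v p allows at most \<open>N D\<close> conflicts per element, and a conflict-free set of the
  right size remains.\<close>

lemma free_subset:
  assumes V: "finite V" "V \<subseteq> carrier G" and v: "v \<in> carrier G"
    and reduced: "\<And>u u'. u \<in> V \<Longrightarrow> u' \<in> V \<Longrightarrow>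
        gromov_product p (\<phi> (inv\<^bsub>G\<^esub> (u \<otimes>\<^bsub>G\<^esub> v)) p) (\<phi> u' (\<phi> v p)) \<le> \<alpha>"
    and long: "\<And>u. u \<in> V \<Longrightarrow> 2 * \<alpha> + 2 * \<delta> < dist (\<phi> u (\<phi> v p)) p"
    and band: "\<And>u u'. u \<in> V \<Longrightarrow> u' \<in> V \<Longrightarrow> dist (\<phi> u (\<phi> v p)) p \<le> dist (\<phi> u' (\<phi> v p)) p + c"
    and close: "\<And>u u'. u \<in> V \<Longrightarrow> u' \<in> V \<Longrightarrow>
        dist (\<phi> u (\<phi> v p)) (\<phi> u' (\<phi> v p)) \<le> c + 2 * \<alpha> + 4 * \<delta> \<Longrightarrow> dist (\<phi> u p) (\<phi> u' p) \<le> D"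
    and D: "0 \<le> D" "c + 2 * \<alpha> + 4 * \<delta> \<le> D" "\<kappa> D \<le> dist (\<phi> v p) p"
  shows "\<exists>W \<subseteq> (\<lambda>u. u \<otimes>\<^bsub>G\<^esub> v) ` V. freely_generates_semigroup G W \<and> real (card V) \<le> N D * real (card W)"
proof -
  \<comment> \<open>The disjunct \<open>u = u'\<close> makes \<open>R\<close> reflexive whatever the
    sign of the threshold.\<close>
  define R where "R u u' \<longleftrightarrow> u = u' \<or> dist (\<phi> u (\<phi> v p)) (\<phi> u' (\<phi> v p)) \<le> c + 2 * \<alpha> + 4 * \<delta>" for u u'
  have deg: "real (card {w \<in> V. R u w}) \<le> N D" if u: "u \<in> V" for u
  proof -
    have "{w \<in> V. R u w} \<subseteq>
        {w \<in> V. dist (\<phi> u p) (\<phi> w p) \<le> D \<and> dist (\<phi> u (\<phi> v p)) (\<phi> w (\<phi> v p)) \<le> D}"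
      using close[OF u] D(1,2) by (force simp: R_def)
    then have "card {w \<in> V. R u w} \<le>
        card {w \<in> V. dist (\<phi> u p) (\<phi> w p) \<le> D \<and> dist (\<phi> u (\<phi> v p)) (\<phi> w (\<phi> v p)) \<le> D}"
      using V(1) by (intro card_mono) auto
    moreover have "real (card {w \<in> V. dist (\<phi> u p) (\<phi> w p) \<le> D
        \<and> dist (\<phi> u (\<phi> v p)) (\<phi> w (\<phi> v p)) \<le> D}) \<le> N D"
      using V u D by (intro few_translates) (auto simp: dist_commute)
    ultimately show ?thesis by linarith
  qed
  obtain I where I: "I \<subseteq> V" "\<And>u w. u \<in> I \<Longrightarrow> w \<in> I \<Longrightarrow> u \<noteq> w \<Longrightarrow> \<not> R u w"
    "real (card V) \<le> N D * real (card I)"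
    using separated_subset[OF V(1), of R "N D"] deg by (auto simp: R_def dist_commute)
  let ?W = "(\<lambda>u. u \<otimes>\<^bsub>G\<^esub> v) ` I"
  have IG: "I \<subseteq> carrier G" using I V by auto
  then have act: "\<phi> (u \<otimes>\<^bsub>G\<^esub> v) p = \<phi> u (\<phi> v p)" if "u \<in> I" for u
    using that v by (simp add: act_mult subset_iff)
  have "freely_generates_semigroup G ?W"
  proof (rule reduced_free[where p = p and \<alpha> = \<alpha> and c = c])
    show "?W \<subseteq> carrier G" using IG v by auto
  next
    fix w w' assume "w \<in> ?W" "w' \<in> ?W"
    then show "gromov_product p (\<phi> (inv\<^bsub>G\<^esub> w) p) (\<phi> w' p) \<le> \<alpha>"
      using reduced I(1) by (auto simp: act subset_iff)
  next
    fix w assume "w \<in> ?W"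
    then show "2 * \<alpha> + 2 * \<delta> < dist (\<phi> w p) p"
      using long I(1) by (auto simp: act subset_iff)
  next
    fix w w' assume "w \<in> ?W" "w' \<in> ?W"
    then show "dist (\<phi> w p) p \<le> dist (\<phi> w' p) p + c"
      using band I(1) by (auto simp: act subset_iff)
  next
    fix w w' assume "w \<in> ?W" "w' \<in> ?W" "w \<noteq> w'"
    then obtain u u' where u: "u \<in> I" "u' \<in> I" "u \<noteq> u'" "w = u \<otimes>\<^bsub>G\<^esub> v" "w' = u' \<otimes>\<^bsub>G\<^esub> v"
      by auto
    then show "c + 2 * \<alpha> + 4 * \<delta> < dist (\<phi> w p) (\<phi> w' p)"
      using I(2)[OF u(1-3)] by (simp add: act R_def not_le)
  qed
  moreover have "card ?W = card I"
    using IG v by (intro card_image inj_onI) (simp add: subset_iff)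
  ultimately show ?thesis using I by (intro exI[of _ ?W]) auto
qed

section \<open>The concentrated and the diffuse case\<close>

lemma concentrated_case:
  assumes V: "finite V" "V \<subseteq> carrier G" and v: "v \<in> carrier G"
    and R: "0 \<le> R" "\<And>u. u \<in> V \<Longrightarrow> dist (\<phi> u p) p \<le> R"
    and D2: "D2 = 4 * R + 6 * \<delta>" and \<alpha>: "\<alpha> = \<kappa> D2 + \<delta> + R" and D: "D = 2 * R + 2 * \<alpha> + 4 * \<delta>"
    and far: "\<kappa> D2 \<le> dist (\<phi> v p) p" "\<kappa> D \<le> dist (\<phi> v p) p" "2 * \<alpha> + 2 * \<delta> + R < dist (\<phi> v p) p"
  shows "\<exists>W \<subseteq> (\<lambda>u. u \<otimes>\<^bsub>G\<^esub> v) ` V. freely_generates_semigroup G W \<and>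
    real (card V) \<le> N D2 + N D * real (card W)"
proof -
  \<comment> \<open>The point \<open>q\<close> below lies at distance \<open>s\<close> from p
    towards v p, just far enough for acylindricity with displacement \<open>D2\<close> to apply to p
    and q.\<close>
  define s where "s = \<kappa> D2"
  have s: "0 \<le> s" unfolding s_def using R D2 delta by (intro kappa_nonneg) auto
  \<comment> \<open>For these u the word v (u v) cancels by more than \<open>s + \<delta>\<close> at
    its first junction.\<close>
  define bad where "bad = {u \<in> V. s + \<delta> < gromov_product p (\<phi> (inv\<^bsub>G\<^esub> v) p) (\<phi> u (\<phi> v p))}"
  obtain q where q: "dist q p = s" "dist q (\<phi> v p) \<le> dist (\<phi> v p) p - s + \<delta>"
    using length_space_point[OF len s, of "\<phi> v p" p \<delta>] far(1) delta by (auto simp: s_def)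
  have gq: "s - \<delta> / 2 \<le> gromov_product p q (\<phi> v p)"
    using q by (simp add: gromov_product_def)
  have gq': "s - \<delta> / 2 - R \<le> gromov_product p (\<phi> u q) (\<phi> u (\<phi> v p))" if "u \<in> V" for u
    using gq gp_act[of u p q "\<phi> v p"] gromov_product_base[of "\<phi> u p" "\<phi> u q" "\<phi> u (\<phi> v p)" p]
      that V(2) R(2)[OF that] by force
  have dq: "dist (\<phi> u q) p \<le> s + R" if "u \<in> V" for u
    using dist_triangle[of "\<phi> u q" p "\<phi> u p"] isom[of u q p] q(1) that V(2) R(2)[OF that] by force
  have dp: "dist (\<phi> u p) (\<phi> u' p) \<le> 2 * R" if "u \<in> V" "u' \<in> V" for u u'
    using dist_triangle2[of "\<phi> u p" "\<phi> u' p" p] R(2)[OF that(1)] R(2)[OF that(2)] by linarith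
  \<comment> \<open>For bad elements u v p and u' v p share the direction of v^-1 p up to length
    \<open>s\<close>. As u q and u' q lie near that stretch, they are close, and so are u p and u'
    p; hence \<open>few_translates\<close> bounds the bad set.\<close>
  have bad_close: "dist (\<phi> u q) (\<phi> u' q) \<le> D2" if u: "u \<in> bad" "u' \<in> bad" for u u'
  proof -
    have "s \<le> gromov_product p (\<phi> u (\<phi> v p)) (\<phi> u' (\<phi> v p))"
      using hyp[of p "\<phi> u (\<phi> v p)" "\<phi> (inv\<^bsub>G\<^esub> v) p" "\<phi> u' (\<phi> v p)"] u
        gromov_product_commute[of p "\<phi> u (\<phi> v p)" "\<phi> (inv\<^bsub>G\<^esub> v) p"] by (auto simp: bad_def)
    moreover have "u \<in> V" "u' \<in> V" using u by (auto simp: bad_def)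
    ultimately have "s - \<delta> / 2 - R - 2 * \<delta> \<le> gromov_product p (\<phi> u q) (\<phi> u' q)"
      using hyp3[of p "\<phi> u q" "\<phi> u (\<phi> v p)" "\<phi> u' (\<phi> v p)" "\<phi> u' q"] gq'[of u] gq'[of u'] R(1) delta
        gromov_product_commute[of p "\<phi> u' q" "\<phi> u' (\<phi> v p)"] by linarith
    then show ?thesis
      using dq[OF \<open>u \<in> V\<close>] dq[OF \<open>u' \<in> V\<close>] D2 delta by (simp add: gromov_product_def)
  qed
  have nbad: "real (card bad) \<le> N D2"
  proof (cases "bad = {}")
    case True
    then show ?thesis using N_nonneg[of D2] D2 R(1) delta by simp
  next
    case False
    then obtain u where u: "u \<in> bad" by blast
    have D2R: "2 * R \<le> D2" using D2 R(1) delta by simp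
    have "bad = {w \<in> bad. dist (\<phi> u p) (\<phi> w p) \<le> D2 \<and> dist (\<phi> u q) (\<phi> w q) \<le> D2}"
      using bad_close[OF u] dp[of u] u D2R by (fastforce simp: bad_def)
    moreover have "real (card {w \<in> bad. dist (\<phi> u p) (\<phi> w p) \<le> D2 \<and> dist (\<phi> u q) (\<phi> w q) \<le> D2}) \<le> N D2"
      using u V(2) D2 R(1) delta q(1)
      by (intro few_translates) (auto simp: bad_def s_def dist_commute)
    ultimately show ?thesis by simp
  qed
  have tri: "dist (\<phi> v p) p - R \<le> dist (\<phi> u (\<phi> v p)) p" "dist (\<phi> u (\<phi> v p)) p \<le> dist (\<phi> v p) p + R"
    if "u \<in> V" for u
  proof -
    have "dist (\<phi> u (\<phi> v p)) (\<phi> u p) = dist (\<phi> v p) p" using that V(2) by (auto intro: isom)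
    then show "dist (\<phi> v p) p - R \<le> dist (\<phi> u (\<phi> v p)) p" "dist (\<phi> u (\<phi> v p)) p \<le> dist (\<phi> v p) p + R"
      using dist_triangle[of "\<phi> u (\<phi> v p)" p "\<phi> u p"] dist_triangle2[of "\<phi> u (\<phi> v p)" "\<phi> u p" p] R(2)[OF that]
      by linarith+
  qed
  have "\<exists>W \<subseteq> (\<lambda>u. u \<otimes>\<^bsub>G\<^esub> v) ` (V - bad). freely_generates_semigroup G W \<and>
      real (card (V - bad)) \<le> N D * real (card W)"
  proof (rule free_subset[where p = p and \<alpha> = \<alpha> and c = "2 * R"])
    fix u u' assume u: "u \<in> V - bad" "u' \<in> V - bad"
    then have uG: "u \<in> carrier G" using V by auto
    \<comment> \<open>Since u barely moves p, (u v)^-1 p is within \<open>R\<close> of v^-1 p, where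
      badness was tested. This is the summand \<open>R\<close> in \<alpha>.\<close>
    have "dist (\<phi> (inv\<^bsub>G\<^esub> (u \<otimes>\<^bsub>G\<^esub> v)) p) (\<phi> (inv\<^bsub>G\<^esub> v) p) = dist p (\<phi> u p)"
      using uG v by (simp add: dist_act_inv act_mult act_inv)
    also have "\<dots> \<le> R" using R(2) u by (simp add: dist_commute)
    finally have "gromov_product p (\<phi> (inv\<^bsub>G\<^esub> (u \<otimes>\<^bsub>G\<^esub> v)) p) (\<phi> u' (\<phi> v p))
        \<le> gromov_product p (\<phi> (inv\<^bsub>G\<^esub> v) p) (\<phi> u' (\<phi> v p)) + R"
      using gromov_product_move[of p "\<phi> (inv\<^bsub>G\<^esub> (u \<otimes>\<^bsub>G\<^esub> v)) p" "\<phi> u' (\<phi> v p)" "\<phi> (inv\<^bsub>G\<^esub> v) p"] by linarith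
    also have "\<dots> \<le> \<alpha>" using u \<alpha> by (auto simp: bad_def s_def)
    finally show "gromov_product p (\<phi> (inv\<^bsub>G\<^esub> (u \<otimes>\<^bsub>G\<^esub> v)) p) (\<phi> u' (\<phi> v p)) \<le> \<alpha>" .
    show "dist (\<phi> u (\<phi> v p)) p \<le> dist (\<phi> u' (\<phi> v p)) p + 2 * R"
      using tri[of u] tri[of u'] u by auto
    show "dist (\<phi> u p) (\<phi> u' p) \<le> D"
      using dp[of u u'] u D \<alpha> s R(1) delta by (auto simp: s_def)
  next
    fix u assume "u \<in> V - bad"
    then show "2 * \<alpha> + 2 * \<delta> < dist (\<phi> u (\<phi> v p)) p" using tri[of u] far(3) by auto
  qed (use V v far s \<alpha> D R(1) delta in \<open>auto simp: s_def\<close>)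
  then obtain W where W: "W \<subseteq> (\<lambda>u. u \<otimes>\<^bsub>G\<^esub> v) ` (V - bad)" "freely_generates_semigroup G W"
    "real (card (V - bad)) \<le> N D * real (card W)" by blast
  have "bad \<subseteq> V" by (auto simp: bad_def)
  then have "real (card V) = real (card bad) + real (card (V - bad))"
    using V(1) by (metis Diff_disjoint Diff_partition card_Un_disjoint finite_Diff finite_subset of_nat_add)
  with W nbad show ?thesis by (intro exI[of _ W]) auto
qed

text \<open>Neither u v nor v u backtracks by \<open>T\<close>, and all letters have length at least
  \<open>3 * T\<close>. So each letter keeps a stretch of length at least \<open>2 * T\<close> free
  of cancellation, and words in the products u v are reduced.\<close>

lemma diffuse_case:
  assumes V: "finite V" "V \<subseteq> carrier G" and v: "v \<in> carrier G"
    and gp: "\<And>u. u \<in> V \<Longrightarrow> gromov_product p (\<phi> (inv\<^bsub>G\<^esub> u) p) (\<phi> v p) < T"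
      "\<And>u. u \<in> V \<Longrightarrow> gromov_product p (\<phi> (inv\<^bsub>G\<^esub> v) p) (\<phi> u p) < T"
    and band: "\<And>u u'. u \<in> V \<Longrightarrow> u' \<in> V \<Longrightarrow> dist (\<phi> u p) p \<le> dist (\<phi> u' p) p + 1"
    and T: "3 * \<delta> \<le> T" and D: "D = 8 * T + 15 * \<delta>"
    and far: "3 * T \<le> dist (\<phi> v p) p" "\<kappa> D \<le> dist (\<phi> v p) p"
      "\<And>u. u \<in> V \<Longrightarrow> 3 * T \<le> dist (\<phi> u p) p"
  shows "\<exists>W \<subseteq> (\<lambda>u. u \<otimes>\<^bsub>G\<^esub> v) ` V. freely_generates_semigroup G W \<and> real (card V) \<le> N D * real (card W)"
proof -
  have len_uv: "dist (\<phi> u (\<phi> v p)) p =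
      dist (\<phi> u p) p + dist (\<phi> v p) p - 2 * gromov_product p (\<phi> (inv\<^bsub>G\<^esub> u) p) (\<phi> v p)"
    if "u \<in> V" for u
    using that V(2) dist_act_inv[of u p p] dist_act_inv[of u p "\<phi> v p"]
    by (simp add: gromov_product_def dist_commute subset_iff field_simps)
  have pre: "dist (\<phi> u p) p - T \<le> gromov_product p (\<phi> u p) (\<phi> u (\<phi> v p))" if "u \<in> V" for u
    using gp_continue[of u p "\<phi> v p"] gp(1)[OF that] V(2) that by force
  show ?thesis
  \<comment> \<open>Two applications of hyperbolicity give
    \<open>\<alpha> = T + 2 * \<delta>\<close>. The length of u v is the sum of the two lengths
    minus twice a product in [0, T), and the annulus has width 1, which gives
    \<open>c\<close>.\<close>
  proof (rule free_subset[where p = p and \<alpha> = "T + 2 * \<delta>" and c = "\<delta> + 2 * T"])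
    fix u u' assume u: "u \<in> V" "u' \<in> V"
    then have uG: "u \<in> carrier G" using V by auto
    let ?x = "\<phi> (inv\<^bsub>G\<^esub> (u \<otimes>\<^bsub>G\<^esub> v)) p"
    have "?x = \<phi> (inv\<^bsub>G\<^esub> v) (\<phi> (inv\<^bsub>G\<^esub> u) p)"
      using uG v by (simp add: inv_mult_group act_mult)
    then have "gromov_product p (\<phi> (inv\<^bsub>G\<^esub> v) p) ?x
        = dist (\<phi> v p) p - gromov_product p (\<phi> v p) (\<phi> (inv\<^bsub>G\<^esub> u) p)"
      using gp_continue[of "inv\<^bsub>G\<^esub> v" p "\<phi> (inv\<^bsub>G\<^esub> u) p"] v dist_act_inv[OF v, of p p]
      by (simp add: dist_commute)
    then have "2 * T \<le> gromov_product p (\<phi> (inv\<^bsub>G\<^esub> v) p) ?x"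
      using gp(1)[OF u(1)] far(1) gromov_product_commute[of p "\<phi> v p"] by simp
    then show "gromov_product p ?x (\<phi> u' (\<phi> v p)) \<le> T + 2 * \<delta>"
      using hyp3[of p "\<phi> (inv\<^bsub>G\<^esub> v) p" ?x "\<phi> u' (\<phi> v p)" "\<phi> u' p"] gp(2)[OF u(2)] pre[OF u(2)]
        far(3)[OF u(2)] gromov_product_commute[of p "\<phi> u' p" "\<phi> u' (\<phi> v p)"] T delta by linarith
    show "dist (\<phi> u (\<phi> v p)) p \<le> dist (\<phi> u' (\<phi> v p)) p + (\<delta> + 2 * T)"
      using len_uv[OF u(1)] len_uv[OF u(2)] gp(1)[OF u(2)] band[OF u] delta
        gromov_product_nonneg[of p "\<phi> (inv\<^bsub>G\<^esub> u) p" "\<phi> v p"] by linarith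
    show "dist (\<phi> u p) (\<phi> u' p) \<le> D"
      if "dist (\<phi> u (\<phi> v p)) (\<phi> u' (\<phi> v p)) \<le> \<delta> + 2 * T + 2 * (T + 2 * \<delta>) + 4 * \<delta>"
    proof -
      \<comment> \<open>Seen from p, the chain u p, u v p, u' v p, u' p keeps one direction up to
        about the mean length \<open>?m\<close>, so its ends are within \<open>D\<close>.\<close>
      let ?m = "(dist (\<phi> u p) p + dist (\<phi> u' p) p) / 2"
      have "gromov_product p (\<phi> u (\<phi> v p)) (\<phi> u' (\<phi> v p)) \<ge> ?m - 4 * T - 5 * \<delta>"
        using that len_uv[OF u(1)] len_uv[OF u(2)] gp(1)[OF u(1)] gp(1)[OF u(2)] far(1) T delta
        unfolding gromov_product_def[of p "\<phi> u (\<phi> v p)"] by (simp add: field_simps)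
      moreover have "gromov_product p (\<phi> u p) (\<phi> u (\<phi> v p)) \<ge> ?m - 4 * T - 5 * \<delta>"
        using pre[OF u(1)] band[OF u(2,1)] T delta by (simp add: field_simps)
      moreover have "gromov_product p (\<phi> u' (\<phi> v p)) (\<phi> u' p) \<ge> ?m - 4 * T - 5 * \<delta>"
        using pre[OF u(2)] band[OF u] T delta
          gromov_product_commute[of p "\<phi> u' p" "\<phi> u' (\<phi> v p)"] by (simp add: field_simps)
      ultimately have "gromov_product p (\<phi> u p) (\<phi> u' p) \<ge> ?m - 4 * T - 7 * \<delta>"
        using hyp3[of p "\<phi> u p" "\<phi> u (\<phi> v p)" "\<phi> u' (\<phi> v p)" "\<phi> u' p"] by linarith
      then show ?thesis using D delta by (simp add: gromov_product_def field_simps)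
    qed
  next
    fix u assume u: "u \<in> V"
    then show "2 * (T + 2 * \<delta>) + 2 * \<delta> < dist (\<phi> u (\<phi> v p)) p"
      using len_uv[OF u] gp(1)[OF u] far(1) far(3)[OF u] T by (simp add: algebra_simps)
  qed (use V v far D T delta in auto)
qed

section \<open>Energy and the counting of backtracking pairs\<close>

text \<open>Move p by \<open>r\<close> towards \<open>a\<close>. The displacement of any u grows by
  at most \<open>2 * r\<close>; it stays about the same if one of u p, u^-1 p lies in the direction
  of \<open>a\<close>, and drops by about \<open>2 * r\<close> if both do. Near-minimality at p
  bounds the total gain from below.\<close>

lemma energy_balance:
  assumes U: "finite U" "U \<subseteq> carrier G" and r: "0 \<le> r"
    and min: "\<And>q. (\<Sum>u\<in>U. dist (\<phi> u p) p) \<le> (\<Sum>u\<in>U. dist (\<phi> u q) q) + \<delta> * real (card U)"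
    and B: "B \<subseteq> U" "\<And>u. u \<in> B \<Longrightarrow> 2 * r \<le> dist (\<phi> u p) p \<and>
        r \<le> gromov_product p (\<phi> u p) a \<and> r \<le> gromov_product p (\<phi> (inv\<^bsub>G\<^esub> u) p) a"
    and O: "O' \<subseteq> U" "\<And>u. u \<in> O' \<Longrightarrow>
        r \<le> gromov_product p (\<phi> u p) a \<or> r \<le> gromov_product p (\<phi> (inv\<^bsub>G\<^esub> u) p) a"
    and BO: "B \<subseteq> O'"
  shows "2 * r * real (card B) + 2 * r * real (card O') \<le> (2 * r + 9 * \<delta>) * real (card U)"
proof (cases "O' = {}")
  case True
  then show ?thesis using BO r delta by simp
next
  case False
  then obtain u0 where "u0 \<in> O'" by blast
  \<comment> \<open>A nonempty \<open>O'\<close> forces \<open>a\<close> to be far enough from p to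
    leave room for \<open>q\<close>.\<close>
  then have "r \<le> dist a p"
    using O(2) gromov_product_le order_trans by metis
  then obtain q where q: "dist q p = r" "dist q a \<le> dist a p - r + \<delta>"
    using length_space_point[OF len r, of a p \<delta>] delta by auto
  then have gq: "r - \<delta> / 2 \<le> gromov_product p q a" by (simp add: gromov_product_def)
  have toward: "dist q y \<le> dist y p - r + 3 * \<delta>" if "r \<le> gromov_product p y a" for y
  proof -
    have "r - 3 * \<delta> / 2 \<le> gromov_product p q y"
      using hyp[of p q a y] gq that gromov_product_commute[of p a y] delta by (simp add: min_def split: if_splits)
    then show ?thesis using q(1) by (simp add: gromov_product_def field_simps)
  qed
  have change: "dist (\<phi> u q) q - dist (\<phi> u p) p \<le>
      2 * r + 8 * \<delta> - 2 * r * (if u \<in> O' then 1 else 0) - 2 * r * (if u \<in> B then 1 else 0)"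
    if u: "u \<in> U" for u
  proof -
    have uG: "u \<in> carrier G" using u U by auto
    note iso = isom[OF uG, of q p]
    have inv: "dist q (\<phi> (inv\<^bsub>G\<^esub> u) p) = dist p (\<phi> u q)" "dist (\<phi> (inv\<^bsub>G\<^esub> u) p) p = dist (\<phi> u p) p"
      using dist_act_inv[OF uG, of p] by (simp_all add: dist_commute)
    have out: "dist q (\<phi> u p) \<le> dist (\<phi> u p) p - r + 3 * \<delta>" if "r \<le> gromov_product p (\<phi> u p) a"
      using toward[OF that] .
    have into: "dist p (\<phi> u q) \<le> dist (\<phi> u p) p - r + 3 * \<delta>" if "r \<le> gromov_product p (\<phi> (inv\<^bsub>G\<^esub> u) p) a"
      using toward[OF that] inv by simp
    consider "u \<in> B" "u \<in> O'" | "u \<notin> B" "u \<in> O'" | "u \<notin> B" "u \<notin> O'" using BO by blast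
    then show ?thesis
    proof cases
      case 1
      \<comment> \<open>Since \<open>2 * r \<le> dist (\<phi> u p) p\<close>, the first entry of the
        maximum is harmless; the second yields the drop by \<open>2 * r\<close>.\<close>
      have "dist q (\<phi> u q) + dist p (\<phi> u p) \<le>
          max (dist (\<phi> u q) (\<phi> u p) + dist q p) (dist q (\<phi> u p) + dist p (\<phi> u q)) + 2 * \<delta>"
        by (rule four_point)
      then show ?thesis
        using 1 B(2)[OF 1(1)] out into iso q(1) delta
        by (auto simp: dist_commute max_def split: if_splits)
    next
      case 2
      have "dist q (\<phi> u q) \<le> dist q (\<phi> u p) + dist (\<phi> u p) (\<phi> u q)"
        "dist q (\<phi> u q) \<le> dist q p + dist p (\<phi> u q)"
        by (rule dist_triangle)+
      then have "dist q (\<phi> u q) \<le> dist (\<phi> u p) p + 3 * \<delta>"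
        using O(2)[OF 2(2)] out into iso q(1) by (auto simp: dist_commute)
      then show ?thesis using 2 delta by (simp add: dist_commute)
    next
      case 3
      then show ?thesis
        using dist_triangle[of "\<phi> u q" q "\<phi> u p"] dist_triangle[of "\<phi> u p" q p] iso q(1) delta
        by (simp add: dist_commute)
    qed
  qed
  have "(\<Sum>u\<in>U. dist (\<phi> u q) q) - (\<Sum>u\<in>U. dist (\<phi> u p) p) = (\<Sum>u\<in>U. dist (\<phi> u q) q - dist (\<phi> u p) p)"
    by (simp add: sum_subtractf)
  also have "\<dots> \<le> (\<Sum>u\<in>U. 2 * r + 8 * \<delta> - 2 * r * (if u \<in> O' then 1 else 0) - 2 * r * (if u \<in> B then 1 else 0))"
    using change by (rule sum_mono)
  also have "\<dots> = (2 * r + 8 * \<delta>) * real (card U) - 2 * r * (\<Sum>u\<in>U. if u \<in> O' then 1 else 0)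
      - 2 * r * (\<Sum>u\<in>U. if u \<in> B then 1 else 0)"
    by (simp only: sum_subtractf sum_distrib_left[symmetric] sum_constant) simp
  also have "(\<Sum>u\<in>U. if u \<in> O' then 1 else 0) = real (card O')"
    using U(1) O(1) by (simp add: sum.If_cases Int_absorb1)
  also have "(\<Sum>u\<in>U. if u \<in> B then 1 else 0) = real (card B)"
    using U(1) B(1) by (simp add: sum.If_cases Int_absorb1)
  finally show ?thesis using min[of q] by (simp add: algebra_simps)
qed

text \<open>By contradiction: otherwise every set of pairwise non-backtracking elements has fewer
  than \<open>n / 10\<close> members, while nearly all of \<open>U'\<close> backtracks against any
  given v. Covering the backtracking elements by few such sets is then impossible.\<close>

lemma non_backtracking:
  assumes U: "finite U" "U \<subseteq> carrier G" "U \<noteq> {}"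
    and min: "\<And>q. (\<Sum>u\<in>U. dist (\<phi> u p) p) \<le> (\<Sum>u\<in>U. dist (\<phi> u q) q) + \<delta> * real (card U)"
    and U': "U' \<subseteq> U" "\<And>u. u \<in> U' \<Longrightarrow> 2000 * \<delta> \<le> dist (\<phi> u p) p"
      "98 * real (card U) \<le> 100 * real (card U')"
    and T: "T = 1003 * \<delta>"
  obtains v V where "v \<in> U'" "V \<subseteq> U'" "real (card U) \<le> 10 * real (card V)"
    "\<forall>u\<in>V. gromov_product p (\<phi> (inv\<^bsub>G\<^esub> u) p) (\<phi> v p) < T
      \<and> gromov_product p (\<phi> (inv\<^bsub>G\<^esub> v) p) (\<phi> u p) < T"
proof (rule ccontr)
  assume contr: "\<not> thesis"
  note result = that
  \<comment> \<open>\<open>gp (i u) (o' v)\<close> measures the cancellation in the word u v, and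
    \<open>gp (i v) (o' u)\<close> that in v u.\<close>
  define i where "i u = \<phi> (inv\<^bsub>G\<^esub> u) p" for u
  define o' where "o' u = \<phi> u p" for u
  define gp where "gp = gromov_product p"
  define n where "n = real (card U)"
  have fin: "finite U'" using U U' finite_subset by blast
  have n: "0 < n" using U by (simp add: n_def card_gt_0_iff)
  have sym: "gp x y = gp y x" for x y unfolding gp_def by (rule gromov_product_commute)
  have tr: "min (gp x y) (gp y z) - \<delta> \<le> gp x z" for x y z unfolding gp_def by (rule hyp)
  have small: "10 * real (card V) < n"
    if "v \<in> U'" "V \<subseteq> U'" "\<And>u. u \<in> V \<Longrightarrow> gp (i u) (o' v) < T \<and> gp (i v) (o' u) < T" for v V
    using contr result[of v V] that unfolding n_def gp_def i_def o'_def
    by (meson not_le)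
  have clique: "10 * real (card S) < n"
    if "S \<subseteq> U'" "\<And>u w. u \<in> S \<Longrightarrow> w \<in> S \<Longrightarrow> gp (i u) (o' w) < T" for S
  proof (cases "S = {}")
    case True
    then show ?thesis using n by simp
  next
    case False
    then obtain v where "v \<in> S" by blast
    then show ?thesis using small[of v S] that by blast
  qed
  define S1 where "S1 v = {u \<in> U'. T \<le> gp (i u) (o' v)}" for v
  define S2 where "S2 v = {u \<in> U'. T \<le> gp (i v) (o' u)}" for v
  \<comment> \<open>98 percent of \<open>n\<close> lie in \<open>U'\<close>, and fewer than 10
    percent avoid both sets.\<close>
  have most: "88 * n < 100 * real (card (S1 v \<union> S2 v))" if v: "v \<in> U'" for v
  proof -
    let ?S = "S1 v \<union> S2 v"
    have "10 * real (card (U' - ?S)) < n"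
      by (rule small[OF v]) (auto simp: S1_def S2_def)
    moreover have "?S \<subseteq> U'" by (auto simp: S1_def S2_def)
    then have "real (card U') = real (card ?S) + real (card (U' - ?S))"
      using fin by (metis Diff_disjoint Diff_partition card_Un_disjoint finite_Diff finite_subset of_nat_add)
    ultimately show ?thesis using U'(3) by (simp add: n_def)
  qed
  show False
  proof (cases "\<exists>v\<in>U'. T - 2 * \<delta> \<le> gp (o' v) (i v)")
    case False
    (* No element of U' is elliptic-looking at p: the u whose point i u shares the direction of o' v
       form a set of pairwise non-backtracking elements, and so do the u whose o' u shares that of i v. *)
    obtain v where v: "v \<in> U'" using U'(3) n by (cases "U' = {}") (auto simp: n_def)
    have "10 * real (card (S1 v)) < n"
    proof (rule clique)
      fix u w assume uw: "u \<in> S1 v" "w \<in> S1 v"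
      show "gp (i u) (o' w) < T"
      proof (rule ccontr)
        assume "\<not> gp (i u) (o' w) < T"
        with uw have "T - 2 * \<delta> \<le> gp (o' w) (i w)"
          using tr[of "o' w" "i u" "i w"] tr[of "i u" "o' v" "i w"] sym[of "o' v" "i w"]
            sym[of "o' w" "i u"] delta by (auto simp: S1_def min_def split: if_splits)
        with False uw show False by (auto simp: S1_def)
      qed
    qed (auto simp: S1_def)
    moreover have "10 * real (card (S2 v)) < n"
    proof (rule clique)
      fix u w assume uw: "u \<in> S2 v" "w \<in> S2 v"
      show "gp (i u) (o' w) < T"
      proof (rule ccontr)
        assume "\<not> gp (i u) (o' w) < T"
        with uw have "T - 2 * \<delta> \<le> gp (o' u) (i u)"
          using tr[of "o' u" "o' w" "i u"] tr[of "o' u" "i v" "o' w"] sym[of "i v" "o' u"]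
            sym[of "o' w" "i u"] delta by (auto simp: S2_def min_def split: if_splits)
        with False uw show False by (auto simp: S2_def)
      qed
    qed (auto simp: S2_def)
    ultimately show False
      using most[OF v] card_Un_le[of "S1 v" "S2 v"] n by linarith
  next
    case True
    then obtain v where v: "v \<in> U'" and vv: "T - 2 * \<delta> \<le> gp (o' v) (i v)" by blast
    (* Now i v and o' v have the same direction a. Almost every u has i u or o' u in that direction,
       so by energy_balance few u have both, which makes S1 v - B and S2 v - B non-backtracking.
       The gap T - r = 3 * \<delta> absorbs the losses in chaining the hyperbolicity inequality. *)
    define r where "r = 1000 * \<delta>"
    have r: "r = T - 3 * \<delta>" using T by (simp add: r_def)
    define O' where "O' = S1 v \<union> S2 v"
    have S1r: "r \<le> gp (i u) (o' v)" if "u \<in> S1 v" for u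
      using that r delta by (auto simp: S1_def)
    have S2r: "r \<le> gp (o' u) (o' v)" if "u \<in> S2 v" for u
      using that vv tr[of "o' u" "i v" "o' v"] sym[of "o' u" "i v"] sym[of "o' v" "i v"] r delta
      by (auto simp: S2_def min_def split: if_splits)
    define B where "B = {u \<in> O'. r \<le> gp (o' u) (o' v) \<and> r \<le> gp (i u) (o' v)}"
    have OU: "O' \<subseteq> U'" by (auto simp: O'_def S1_def S2_def)
    have "2 * r * real (card B) + 2 * r * real (card O') \<le> (2 * r + 9 * \<delta>) * n"
      unfolding n_def
    proof (rule energy_balance[OF U(1,2) _ min, where a = "o' v"])
      show "0 \<le> r" using delta by (simp add: r_def)
      show "B \<subseteq> U" "O' \<subseteq> U" "B \<subseteq> O'" using OU U' by (auto simp: B_def)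
      fix u
      show "2 * r \<le> dist (\<phi> u p) p \<and> r \<le> gromov_product p (\<phi> u p) (o' v) \<and>
          r \<le> gromov_product p (\<phi> (inv\<^bsub>G\<^esub> u) p) (o' v)" if "u \<in> B"
        using that OU U'(2)[of u] by (auto simp: B_def r_def gp_def o'_def i_def)
      show "r \<le> gromov_product p (\<phi> u p) (o' v) \<or> r \<le> gromov_product p (\<phi> (inv\<^bsub>G\<^esub> u) p) (o' v)"
        if "u \<in> O'"
        using that S1r S2r by (auto simp: O'_def gp_def o'_def i_def)
    qed
    then have "\<delta> * (2000 * real (card B) + 2000 * real (card O')) \<le> \<delta> * (2009 * n)"
      by (simp add: r_def algebra_simps)
    then have bal: "2000 * real (card B) + 2000 * real (card O') \<le> 2009 * n"
      using delta by (simp del: distrib_left_numeral)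
    have "10 * real (card (S1 v - B)) < n"
    proof (rule clique)
      fix u w assume uw: "u \<in> S1 v - B" "w \<in> S1 v - B"
      show "gp (i u) (o' w) < T"
      proof (rule ccontr)
        assume "\<not> gp (i u) (o' w) < T"
        with uw have "r \<le> gp (o' w) (o' v)"
          using tr[of "o' w" "i u" "o' v"] sym[of "o' w" "i u"] r delta
          by (auto simp: S1_def min_def split: if_splits)
        with uw S1r[of w] show False by (auto simp: B_def O'_def)
      qed
    qed (auto simp: S1_def)
    moreover have "10 * real (card (S2 v - B)) < n"
    proof (rule clique)
      fix u w assume uw: "u \<in> S2 v - B" "w \<in> S2 v - B"
      show "gp (i u) (o' w) < T"
      proof (rule ccontr)
        assume "\<not> gp (i u) (o' w) < T"
        with uw have "r \<le> gp (i u) (o' v)"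
          using tr[of "i u" "o' w" "i v"] tr[of "i u" "i v" "o' v"] sym[of "o' w" "i v"]
            sym[of "o' v" "i v"] vv r delta
          by (auto simp: S2_def min_def split: if_splits)
        with uw S2r[of u] show False by (auto simp: B_def O'_def)
      qed
    qed (auto simp: S2_def)
    moreover have "card O' \<le> card (S1 v - B) + card (S2 v - B) + card B"
    proof -
      have "finite O'" using OU fin finite_subset by blast
      then have "card O' \<le> card ((S1 v - B) \<union> (S2 v - B) \<union> B)"
        by (intro card_mono) (auto simp: O'_def B_def)
      also have "\<dots> \<le> card ((S1 v - B) \<union> (S2 v - B)) + card B" by (rule card_Un_le)
      also have "card ((S1 v - B) \<union> (S2 v - B)) \<le> card (S1 v - B) + card (S2 v - B)" by (rule card_Un_le)
      finally show ?thesis by simp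
    qed
    \<comment> \<open>\<open>bal\<close> leaves less than 13 percent of \<open>n\<close> for
      \<open>B\<close>; with twice 10 percent for the other two sets, \<open>O'\<close> stays far
      below 88 percent.\<close>
    ultimately show False using most[OF v] bal n unfolding O'_def by linarith
  qed
qed

lemma almost_minimal_energy:
  assumes "finite U" "U \<noteq> {}"
  obtains p where "\<And>q. (\<Sum>u\<in>U. dist (\<phi> u p) p) \<le> (\<Sum>u\<in>U. dist (\<phi> u q) q) + \<delta> * real (card U)"
proof -
  define F where "F q = (\<Sum>u\<in>U. dist (\<phi> u q) q)" for q
  have bdd: "bdd_below (range F)" by (auto simp: F_def intro!: bdd_belowI[of _ 0] sum_nonneg)
  have "Inf (range F) < Inf (range F) + \<delta> * real (card U)"
    using assms delta by (simp add: card_gt_0_iff)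
  then obtain p where p: "F p < Inf (range F) + \<delta> * real (card U)"
    using cInf_less_iff[OF _ bdd] by (metis empty_not_UNIV image_is_empty rangeE)
  have "F p \<le> F q + \<delta> * real (card U)" for q
    using p cInf_lower[OF _ bdd, of "F q"] by simp
  then show thesis unfolding F_def by (rule that)
qed

section \<open>Choice of constants and assembly of the two cases\<close>

text \<open>Here \<open>l\<close> stands for the energy as a real number, \<open>x\<close> for a
  point almost realising it, and the condition on all \<open>y\<close> for energy above
  \<open>C\<close>.\<close>

lemma large_free_subset:
  "\<exists>C\<ge>1. \<forall>U l x. finite U \<and> U \<subseteq> carrier G \<and> C < real (card U) \<and> C < l \<and>
      (\<forall>u\<in>U. dist (\<phi> u x) x \<le> l + 1) \<and> (\<forall>y. \<exists>v\<in>U. C < dist (\<phi> v y) y) \<longrightarrow>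
      (\<exists>W \<subseteq> U <#>\<^bsub>G\<^esub> U. freely_generates_semigroup G W \<and> real (card U) \<le> C * l * real (card W))"
proof -
  \<comment> \<open>No circularity: \<open>T\<close> and \<open>D1\<close> depend on \<delta> only,
    the threshold \<open>R\<close> is taken large enough for the diffuse case, and
    \<open>D2\<close>, \<open>\<alpha>\<close>, \<open>D\<close> for the concentrated case follow
    from \<open>R\<close>.\<close>
  define T where "T = 1003 * \<delta>"
  define D1 where "D1 = 8 * T + 15 * \<delta>"
  define R where "R = max (3 * T) (\<kappa> D1)"
  define D2 where "D2 = 4 * R + 6 * \<delta>"
  define \<alpha> where "\<alpha> = \<kappa> D2 + \<delta> + R"
  define D where "D = 2 * R + 2 * \<alpha> + 4 * \<delta>"
  have TR: "3 * \<delta> \<le> T" "3 * T \<le> R" "0 \<le> R" "\<kappa> D1 \<le> R" "2000 * \<delta> \<le> R"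
    using delta by (auto simp: T_def R_def max_def)
  have pos: "0 \<le> D1" "0 \<le> D2" using TR delta by (auto simp: D1_def D2_def)
  then have pos': "0 \<le> D" using TR delta kappa_nonneg[of D2] by (auto simp: D_def \<alpha>_def)
  note Ns = N_nonneg[OF pos(1)] N_nonneg[OF pos(2)] N_nonneg[OF pos']
  \<comment> \<open>200 is twice the inverse of the proportion 1/100 separating the cases; 2010 is
    10 from \<open>non_backtracking\<close> times 201 from
    \<open>200 * l + 1 \<le> 201 * l\<close>.\<close>
  define C where "C = 1 + \<delta> + \<kappa> D2 + \<kappa> D + (2 * \<alpha> + 2 * \<delta> + R) + 200 * N D2 + 200 * N D + 2010 * N D1"
  have ks: "0 \<le> \<kappa> D2" "0 \<le> \<kappa> D" using pos pos' kappa_nonneg by auto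
  have Cge: "1 + \<delta> \<le> C" "\<kappa> D2 \<le> C" "\<kappa> D \<le> C" "2 * \<alpha> + 2 * \<delta> + R \<le> C"
    "200 * N D2 \<le> C" "200 * N D \<le> C" "2010 * N D1 \<le> C"
    using Ns ks TR delta by (auto simp: C_def \<alpha>_def)
  have key: "\<exists>W \<subseteq> U <#>\<^bsub>G\<^esub> U. freely_generates_semigroup G W \<and> real (card U) \<le> C * l * real (card W)"
    if U: "finite U" "U \<subseteq> carrier G" "C < real (card U)" and l: "C < l"
      and x: "\<And>u. u \<in> U \<Longrightarrow> dist (\<phi> u x) x \<le> l + 1" and far: "\<And>y. \<exists>v\<in>U. C < dist (\<phi> v y) y" for U l x
  proof -
    have Une: "U \<noteq> {}" using U(3) Cge(1) delta by auto
    have C1: "1 \<le> C" "1 \<le> l" using Cge l delta by auto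
    define n where "n = real (card U)"
    obtain p where p: "\<And>q. (\<Sum>u\<in>U. dist (\<phi> u p) p) \<le> (\<Sum>u\<in>U. dist (\<phi> u q) q) + \<delta> * real (card U)"
      using almost_minimal_energy[OF U(1) Une] by blast
    define V0 where "V0 = {u \<in> U. dist (\<phi> u p) p \<le> R}"
    have prod: "(\<lambda>u. u \<otimes>\<^bsub>G\<^esub> v) ` V \<subseteq> U <#>\<^bsub>G\<^esub> U" if "v \<in> U" "V \<subseteq> U" for v V
      using that by (auto simp: set_mult_def)
    show ?thesis
    proof (cases "n \<le> 100 * real (card V0)")
      case True
      obtain v where v: "v \<in> U" "C < dist (\<phi> v p) p" using far by blast
      have "\<exists>W \<subseteq> (\<lambda>u. u \<otimes>\<^bsub>G\<^esub> v) ` V0. freely_generates_semigroup G W \<and>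
          real (card V0) \<le> N D2 + N D * real (card W)"
        by (rule concentrated_case[OF _ _ _ TR(3) _ D2_def \<alpha>_def D_def])
          (use U v Cge in \<open>auto simp: V0_def\<close>)
      then obtain W where W: "W \<subseteq> (\<lambda>u. u \<otimes>\<^bsub>G\<^esub> v) ` V0" "freely_generates_semigroup G W"
        "real (card V0) \<le> N D2 + N D * real (card W)" by blast
      \<comment> \<open>\<open>100 * N D2\<close> is at most half of \<open>C\<close>, hence less
        than \<open>n / 2\<close>, and is absorbed on the left.\<close>
      have "n \<le> 200 * N D * real (card W)" using W(3) True U(3) Cge(5) by (simp add: n_def)
      also have "\<dots> \<le> C * real (card W)" using Cge by (intro mult_right_mono) auto
      also have "\<dots> \<le> C * l * real (card W)" using C1 by (intro mult_right_mono) auto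
      finally show ?thesis
        using W(2) order_trans[OF W(1) prod[OF v(1)]] unfolding n_def V0_def by blast
    next
      case False
      define U' where "U' = {u \<in> U. R < dist (\<phi> u p) p \<and> dist (\<phi> u p) p \<le> 200 * l}"
      define H where "H = {u \<in> U. 200 * l < dist (\<phi> u p) p}"
      \<comment> \<open>Markov inequality: the mean displacement at p is at most that at x plus
        \<delta>, hence at most \<open>2 * l\<close>.\<close>
      have "200 * l * real (card H) = (\<Sum>u\<in>H. 200 * l)" by simp
      also have "\<dots> \<le> (\<Sum>u\<in>H. dist (\<phi> u p) p)" by (intro sum_mono) (auto simp: H_def)
      also have "\<dots> \<le> (\<Sum>u\<in>U. dist (\<phi> u p) p)" using U by (intro sum_mono2) (auto simp: H_def)
      also have "\<dots> \<le> (\<Sum>u\<in>U. dist (\<phi> u x) x) + \<delta> * n" using p[of x] by (simp add: n_def)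
      also have "(\<Sum>u\<in>U. dist (\<phi> u x) x) \<le> (\<Sum>u\<in>U. l + 1)" using x by (rule sum_mono)
      also have "\<dots> + \<delta> * n = (l + (1 + \<delta>)) * n" by (simp add: n_def algebra_simps)
      also have "\<dots> \<le> (2 * l) * n" using Cge(1) l by (intro mult_right_mono) (auto simp: n_def)
      finally have "(2 * l) * (100 * real (card H)) \<le> (2 * l) * n" by simp
      then have H: "100 * real (card H) \<le> n" using C1 by simp
      have "U \<subseteq> U' \<union> V0 \<union> H" by (auto simp: U'_def V0_def H_def)
      then have "card U \<le> card (U' \<union> V0 \<union> H)"
        using U(1) by (intro card_mono) (auto simp: U'_def V0_def H_def)
      then have "card U \<le> card U' + (card V0 + card H)"
        using card_Un_le[of "U' \<union> V0" H] card_Un_le[of U' V0] by linarith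
      then have U'c: "98 * real (card U) \<le> 100 * real (card U')"
        using False H by (simp add: n_def)
      have U'U: "U' \<subseteq> U" by (auto simp: U'_def)
      have U'far: "2000 * \<delta> \<le> dist (\<phi> u p) p" if "u \<in> U'" for u using that TR by (auto simp: U'_def)
      obtain v V where v: "v \<in> U'" and V: "V \<subseteq> U'" "real (card U) \<le> 10 * real (card V)"
        and gp: "\<forall>u\<in>V. gromov_product p (\<phi> (inv\<^bsub>G\<^esub> u) p) (\<phi> v p) < T
          \<and> gromov_product p (\<phi> (inv\<^bsub>G\<^esub> v) p) (\<phi> u p) < T"
        by (rule non_backtracking[OF U(1,2) Une p U'U U'far U'c T_def])
      have Vfin: "finite V" by (rule finite_subset[OF order_trans[OF V(1) U'U] U(1)])
      have Vb: "0 \<le> dist (\<phi> u p) p \<and> dist (\<phi> u p) p \<le> 200 * l" if "u \<in> V" for u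
        using that V by (auto simp: U'_def)
      obtain V' where V': "V' \<subseteq> V" "\<forall>u\<in>V'. \<forall>w\<in>V'. dist (\<phi> u p) p \<le> dist (\<phi> w p) p + 1"
        "real (card V) \<le> (200 * l + 1) * real (card V')"
        by (rule pigeonhole_bands[OF Vfin Vb])
      have R': "R < dist (\<phi> u p) p" if "u \<in> U'" for u using that by (simp add: U'_def)
      have sub: "V' \<subseteq> U'" using V V' by blast
      have "\<exists>W \<subseteq> (\<lambda>u. u \<otimes>\<^bsub>G\<^esub> v) ` V'. freely_generates_semigroup G W \<and>
          real (card V') \<le> N D1 * real (card W)"
      proof (rule diffuse_case[where p = p and T = T])
        show "finite V'" by (rule finite_subset[OF V'(1) Vfin])
        show "V' \<subseteq> carrier G" "v \<in> carrier G" using sub U'U U v by auto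
        show "3 * T \<le> dist (\<phi> v p) p" "\<kappa> D1 \<le> dist (\<phi> v p) p" using R'[OF v] TR by auto
        show "3 * T \<le> dist (\<phi> u p) p" if "u \<in> V'" for u using R'[of u] TR that sub by auto
      qed (use gp V' TR D1_def in auto)
      then obtain W where W: "W \<subseteq> (\<lambda>u. u \<otimes>\<^bsub>G\<^esub> v) ` V'" "freely_generates_semigroup G W"
        "real (card V') \<le> N D1 * real (card W)" by blast
      have "n \<le> 10 * ((200 * l + 1) * real (card V'))" using V(2) V'(3) by (simp add: n_def)
      also have "\<dots> \<le> 10 * ((201 * l) * (N D1 * real (card W)))"
        using W(3) C1 by (intro mult_left_mono mult_mono) auto
      also have "\<dots> = (2010 * N D1) * (l * real (card W))" by simp
      also have "\<dots> \<le> C * (l * real (card W))" using Cge(7) C1 by (intro mult_right_mono) auto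
      finally have "real (card U) \<le> C * l * real (card W)" by (simp add: n_def mult.assoc)
      then show ?thesis
        using W(2) order_trans[OF W(1) prod[of v V']] v sub U'U by blast
    qed
  qed
  show ?thesis
  proof (intro exI[of _ C] conjI allI impI)
    show "1 \<le> C" using Cge delta by simp
  qed (elim conjE, rule key, auto)
qed

end

section \<open>Passage to the extended real energy\<close>

lemma linf_energy_finite:
  assumes "finite U"
  shows "linf_energy \<phi> U < \<infinity>"
proof -
  have "linf_energy \<phi> U \<le> (SUP u\<in>U. ennreal (dist (\<phi> u undefined) undefined))"
    unfolding linf_energy_def by (rule INF_lower) simp
  also have "\<dots> \<le> ennreal (\<Sum>u\<in>U. dist (\<phi> u undefined) undefined)"
    using assms by (intro SUP_least ennreal_leI member_le_sum) auto
  also have "\<dots> < \<infinity>" by simp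
  finally show ?thesis .
qed

theorem theorem1p6:
  fixes G :: "('g, 'm) monoid_scheme"
    and \<phi> :: "'g \<Rightarrow> 'x::metric_space \<Rightarrow> 'x"
  assumes "length_space TYPE('x)"
    and "gromov_hyperbolic TYPE('x)"
    and "isometric_action G \<phi>"
    and "acylindrical G \<phi>"
  shows "\<exists>C::real. C > 0 \<and>
    (\<forall>U. finite U \<and> U \<subseteq> carrier G \<and> linf_energy \<phi> U > ennreal C \<longrightarrow>
       real (card U) \<le> C \<or>
       (\<exists>W. W \<subseteq> U <#>\<^bsub>G\<^esub> U \<and> freely_generates_semigroup G W \<and>
          of_nat (card W) \<ge> (1 / ennreal C) * (1 / linf_energy \<phi> U) * of_nat (card U)))"
proof -
  obtain \<delta> where \<delta>: "\<And>w x y z :: 'x.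
      gromov_product w x z \<ge> min (gromov_product w x y) (gromov_product w y z) - \<delta>"
    using assms(2) unfolding gromov_hyperbolic_def by blast
  obtain N \<kappa> :: "real \<Rightarrow> real" where N\<kappa>: "\<forall>r\<ge>0. N r \<ge> 0 \<and> \<kappa> r \<ge> 0"
    "\<forall>r\<ge>0. \<forall>x y. dist x y \<ge> \<kappa> r \<longrightarrow>
        finite {g \<in> carrier G. dist x (\<phi> g x) \<le> r \<and> dist y (\<phi> g y) \<le> r} \<and>
        real (card {g \<in> carrier G. dist x (\<phi> g x) \<le> r \<and> dist y (\<phi> g y) \<le> r}) \<le> N r"
    using assms(4) unfolding acylindrical_def by (elim exE conjE)
  have act: "group_action G UNIV \<phi>" "\<And>g x y. g \<in> carrier G \<Longrightarrow> dist (\<phi> g x) (\<phi> g y) = dist x y"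
    using assms(3) unfolding isometric_action_def by blast+
  \<comment> \<open>Enlarging the hyperbolicity constant is harmless and gives the normalisation
    \<open>1 \<le> \<delta>\<close>.\<close>
  interpret acylindrical_action G \<phi> "max 1 \<delta>" N \<kappa>
  proof (intro acylindrical_action.intro acylindrical_action_axioms.intro)
    show "min (gromov_product w x y) (gromov_product w y z) - max 1 \<delta> \<le> gromov_product w x z"
      for w x y z :: 'x
      using \<delta>[of w x y z] by linarith
  qed (use act assms(1) N\<kappa> in auto)
  obtain C where C: "1 \<le> C"
    "\<forall>U l x. finite U \<and> U \<subseteq> carrier G \<and> C < real (card U) \<and> C < l \<and>
      (\<forall>u\<in>U. dist (\<phi> u x) x \<le> l + 1) \<and> (\<forall>y. \<exists>v\<in>U. C < dist (\<phi> v y) y) \<longrightarrow>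
      (\<exists>W \<subseteq> U <#>\<^bsub>G\<^esub> U. freely_generates_semigroup G W \<and> real (card U) \<le> C * l * real (card W))"
    using large_free_subset by (elim exE conjE)
  show ?thesis
  proof (intro exI[of _ C] conjI allI impI)
    show "0 < C" using C by simp
    fix U assume U: "finite U \<and> U \<subseteq> carrier G \<and> linf_energy \<phi> U > ennreal C"
    define l where "l = enn2real (linf_energy \<phi> U)"
    have l: "linf_energy \<phi> U = ennreal l"
      using linf_energy_finite[of U \<phi>] U by (simp add: l_def less_top)
    have Cl: "C < l" using U C(1) unfolding l by (metis ennreal_less_iff order_trans zero_le_one)
    \<comment> \<open>The infimum need not be attained, hence a point \<open>x\<close> with slack
      1.\<close>
    have "linf_energy \<phi> U < ennreal (l + 1)" using Cl C(1) unfolding l by (simp add: ennreal_less_iff)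
    then obtain x where "(SUP u\<in>U. ennreal (dist (\<phi> u x) x)) < ennreal (l + 1)"
      unfolding linf_energy_def by (auto simp: INF_less_iff)
    then have x: "dist (\<phi> u x) x \<le> l + 1" if "u \<in> U" for u
      using that Cl C(1) by (meson SUP_lessD ennreal_less_iff less_imp_le zero_le_dist)
    have far: "\<exists>v\<in>U. C < dist (\<phi> v y) y" for y
    proof -
      have "linf_energy \<phi> U \<le> (SUP u\<in>U. ennreal (dist (\<phi> u y) y))"
        unfolding linf_energy_def by (rule INF_lower) simp
      with U have "ennreal C < (SUP u\<in>U. ennreal (dist (\<phi> u y) y))" by (auto intro: less_le_trans)
      then show ?thesis using C(1) by (auto simp: less_SUP_iff ennreal_less_iff)
    qed
    show "real (card U) \<le> C \<or> (\<exists>W. W \<subseteq> U <#>\<^bsub>G\<^esub> U \<and> freely_generates_semigroup G W \<and>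
          of_nat (card W) \<ge> (1 / ennreal C) * (1 / linf_energy \<phi> U) * of_nat (card U))"
    proof (cases "real (card U) \<le> C")
      case False
      then have "finite U \<and> U \<subseteq> carrier G \<and> C < real (card U) \<and> C < l \<and>
          (\<forall>u\<in>U. dist (\<phi> u x) x \<le> l + 1) \<and> (\<forall>y. \<exists>v\<in>U. C < dist (\<phi> v y) y)"
        using U Cl x far by simp
      from C(2)[THEN spec, THEN spec, THEN spec, THEN mp, OF this]
      obtain W where W: "W \<subseteq> U <#>\<^bsub>G\<^esub> U" "freely_generates_semigroup G W"
        "real (card U) \<le> C * l * real (card W)" by (elim exE conjE)
      have Cl0: "0 < C" "0 < l" using C(1) Cl by auto
      have "(1 / ennreal C) * (1 / linf_energy \<phi> U) * of_nat (card U)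
          = ennreal ((1 / C) * (1 / l) * real (card U))"
        using Cl0 by (simp add: l divide_ennreal ennreal_of_nat_eq_real_of_nat flip: ennreal_1 ennreal_mult)
      also have "\<dots> \<le> ennreal (real (card W))"
        using W(3) Cl0 by (intro ennreal_leI) (simp add: field_simps)
      finally show ?thesis using W by (auto simp: ennreal_of_nat_eq_real_of_nat)
    qed simp
  qed
qed

end
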